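(* Let $C,D\subseteq\mathbb{R}^n$ be nonempty, closed and convex sets with $C\cap D\neq\emptyset$, let $\alpha_1,\alpha_2\in(0,2]$, $0<\alpha<\alpha^{\max}$, $\epsilon\in(0,1)$, and let $S=P_D^{\alpha_2}P_C^{\alpha_1}$. Assume that $C$ is affine. Let $x^k\in\mathbb{R}^n$ be the current iterate, $r^k=Sx^k-x^k$, and for a step length $\alpha_k\in(\alpha,\alpha^{\max}]$ let $$x^{k+1}=x^{k+1}(\alpha_k)=\Pi_C(x^k+\alpha_k r^k)$$ be the candidate point of the projected line search. Then the norm of the residual at the candidate point simplifies to $$\|r(x^{k+1})\|_2=\alpha_2\,\mathrm{dist}_D(x^{k+1}),$$ and the projected line search condition $$\|r(x^{k+1})\|_2\le(1-\epsilon)\,\|r(x^{i_{\mathrm{LS}}+1})\|_2$$ is convex in the step length $\alpha_k$; that is, its left-hand side $\alpha_k\mapsto\|r(x^{k+1}(\alpha_k))\|_2$ is a convex function of $\alpha_k$ (the right-hand side does not depend on $\alpha_k$).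
   Context: For a nonempty closed convex set $\Omega\subseteq\mathbb{R}^n$, $\Pi_\Omega$ denotes the orthogonal (Euclidean) projection onto $\Omega$, $\mathrm{dist}_\Omega(x)=\|\Pi_\Omega x-x\|_2$, and for $\gamma\in(0,2]$ the relaxed projection is $P_\Omega^{\gamma}=(1-\gamma)\mathrm{Id}+\gamma\,\Pi_\Omega$. For $x\in\mathbb{R}^n$ the residual is $r(x):=Sx-x$. In the projected line search condition, $i_{\mathrm{LS}}<k$ is the index of the most recent earlier iteration at which a line search step was taken, and $x^{i_{\mathrm{LS}}+1}$ is the (already computed, fixed) iterate produced by it. *)

theory Defs
  imports "HOL-Analysis.Analysis"
begin

definition proj_dist :: "(real ^ 'n) set \<Rightarrow> real ^ 'n \<Rightarrow> real" where
  "proj_dist \<Omega> x = norm (closest_point \<Omega> x - x)"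

definition relaxed_proj :: "real \<Rightarrow> (real ^ 'n) set \<Rightarrow> real ^ 'n \<Rightarrow> real ^ 'n" where
  "relaxed_proj \<gamma> \<Omega> x = (1 - \<gamma>) *\<^sub>R x + \<gamma> *\<^sub>R closest_point \<Omega> x"

definition alt_proj_op ::
    "(real ^ 'n) set \<Rightarrow> (real ^ 'n) set \<Rightarrow> real \<Rightarrow> real \<Rightarrow> real ^ 'n \<Rightarrow> real ^ 'n" where
  "alt_proj_op C D \<alpha>1 \<alpha>2 = relaxed_proj \<alpha>2 D \<circ> relaxed_proj \<alpha>1 C"

definition fp_residual :: "(real ^ 'n \<Rightarrow> real ^ 'n) \<Rightarrow> real ^ 'n \<Rightarrow> real ^ 'n" where
  "fp_residual S x = S x - x"

definition ls_candidate ::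
    "(real ^ 'n) set \<Rightarrow> (real ^ 'n \<Rightarrow> real ^ 'n) \<Rightarrow> real ^ 'n \<Rightarrow> real \<Rightarrow> real ^ 'n" where
  "ls_candidate C S x a = closest_point C (x + a *\<^sub>R fp_residual S x)"

text \<open>Here \<open>x\<close> is the current iterate, \<open>a\<close> the step length to be tested, and \<open>y\<close> the
  iterate produced by the most recent earlier line search step.\<close>

definition ls_condition ::
    "(real ^ 'n) set \<Rightarrow> (real ^ 'n \<Rightarrow> real ^ 'n) \<Rightarrow> real \<Rightarrow> real ^ 'n \<Rightarrow> real ^ 'n \<Rightarrow> real \<Rightarrow> bool"
  where
  "ls_condition C S \<epsilon> y x a \<longleftrightarrow>
     norm (fp_residual S (ls_candidate C S x a)) \<le> (1 - \<epsilon>) * norm (fp_residual S y)"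

end

theory Submission
  imports Defs
begin

text \<open>The projection onto an affine set is an affine map, so the candidate point is an affine
  function of the step length. Since the candidate lies in \<open>C\<close>, the inner relaxed projection fixes
  it and its residual is \<open>\<alpha>2\<close> times the displacement to its projection onto \<open>D\<close>. The residual norm
  is thus the convex function \<open>\<alpha>2 * proj_dist D\<close> composed with an affine map.\<close>

text \<open>The obtuse-angle inequality \<open>closest_point_dot\<close> is in fact an equality
  here: an affine set contains, with each point, its reflection through the projection, and the
  reflected point reverses the sign. Subtracting two such equalities gives orthogonality to every
  direction of \<open>A\<close>.\<close>

lemma closest_point_affine_orthogonal:
  fixes A :: "'a::{real_inner,heine_borel} set"
  assumes "affine A" "closed A" "y \<in> A" "z \<in> A"
  shows "inner (x - closest_point A x) (y - z) = 0"
proof -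
  let ?p = "closest_point A x"
  have p: "?p \<in> A"
    using assms by (intro closest_point_in_set) auto
  have le: "inner (x - ?p) (w - ?p) \<le> 0" if "w \<in> A" for w
    using closest_point_dot[OF affine_imp_convex[OF assms(1)] assms(2) that] .
  have eq: "inner (x - ?p) (w - ?p) = 0" if w: "w \<in> A" for w
  proof (rule antisym[OF le[OF w]])
    \<comment> \<open>This is the reflection of \<open>w\<close> through \<open>?p\<close>; its
      offset from \<open>?p\<close> is the negative of that of \<open>w\<close>.\<close>
    have "(-1) *\<^sub>R w + 2 *\<^sub>R ?p \<in> A"
      using mem_affine[OF assms(1) w p, of "-1" 2] by simp
    from le[OF this] show "0 \<le> inner (x - ?p) (w - ?p)"
      by (simp add: inner_diff_right inner_add_right algebra_simps)
  qed
  have "inner (x - ?p) (y - z) = inner (x - ?p) (y - ?p) - inner (x - ?p) (z - ?p)"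
    by (simp add: inner_diff_right)
  then show ?thesis
    using eq assms(3,4) by simp
qed

lemma closest_point_affine_comb:
  fixes A :: "'a::{real_inner,heine_borel} set"
  assumes "affine A" "closed A" "A \<noteq> {}" "u + v = 1"
  shows "closest_point A (u *\<^sub>R x + v *\<^sub>R y) = u *\<^sub>R closest_point A x + v *\<^sub>R closest_point A y"
    (is "?q = ?p")
proof -
  have q: "?q \<in> A" and p: "?p \<in> A"
    using assms by (simp_all add: closest_point_in_set mem_affine)
  note orth = closest_point_affine_orthogonal[OF assms(1,2) p q]
  \<comment> \<open>The difference is written as a combination of three displacements from a
    projection to the projected point. Each is orthogonal to \<open>?p - ?q\<close>, a difference of
    points of \<open>A\<close>, so \<open>?p - ?q\<close> is orthogonal to itself.\<close>
  have "?p - ?q = (u *\<^sub>R x + v *\<^sub>R y - ?q) - u *\<^sub>R (x - closest_point A x) - v *\<^sub>R (y - closest_point A y)"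
    by (simp add: algebra_simps)
  then have "inner (?p - ?q) (?p - ?q) =
      inner ((u *\<^sub>R x + v *\<^sub>R y - ?q) - u *\<^sub>R (x - closest_point A x) - v *\<^sub>R (y - closest_point A y)) (?p - ?q)"
    by metis
  also have "\<dots> = 0"
    using orth[of "u *\<^sub>R x + v *\<^sub>R y"] orth[of x] orth[of y] by (simp add: inner_diff_left)
  finally show ?thesis by simp
qed

text \<open>By convexity of \<open>D\<close> the same combination of the two projections lies in
  \<open>D\<close>, so it competes with the projection of the combined point; the triangle
  inequality bounds the distance to it.\<close>

lemma convex_on_proj_dist:
  assumes "convex D" "closed D" "D \<noteq> {}"
  shows "convex_on UNIV (proj_dist D)"
  unfolding convex_on_def
proof (intro conjI ballI allI impI)
  fix x y :: "real ^ 'a" and u v :: real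
  assume uv: "0 \<le> u" "0 \<le> v" "u + v = 1"
  let ?p = "closest_point D"
  have "u *\<^sub>R ?p x + v *\<^sub>R ?p y \<in> D"
    using assms uv by (intro convexD closest_point_in_set)
  then have "proj_dist D (u *\<^sub>R x + v *\<^sub>R y) \<le> dist (u *\<^sub>R x + v *\<^sub>R y) (u *\<^sub>R ?p x + v *\<^sub>R ?p y)"
    using closest_point_le[OF assms(2)]
    by (metis dist_commute dist_norm proj_dist_def)
  also have "\<dots> = norm (u *\<^sub>R (?p x - x) + v *\<^sub>R (?p y - y))"
    by (simp add: dist_norm norm_minus_commute[of "u *\<^sub>R x + v *\<^sub>R y"] algebra_simps)
  also have "\<dots> \<le> u * proj_dist D x + v * proj_dist D y"
    using norm_triangle_ineq[of "u *\<^sub>R (?p x - x)" "v *\<^sub>R (?p y - y)"] uv by (simp add: proj_dist_def)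
  finally show "proj_dist D (u *\<^sub>R x + v *\<^sub>R y) \<le> u * proj_dist D x + v * proj_dist D y" .
qed simp

text \<open>Turns convexity of the residual norm into convexity of the set of accepted step
  lengths.\<close>

lemma convex_on_imp_convex_sublevel:
  assumes "convex_on A f"
  shows "convex {x \<in> A. f x \<le> c}"
  unfolding convex_def
proof (intro ballI allI impI)
  fix x y u v
  assume xy: "x \<in> {x \<in> A. f x \<le> c}" "y \<in> {x \<in> A. f x \<le> c}"
    and uv: "0 \<le> (u::real)" "0 \<le> (v::real)" "u + v = 1"
  have "f (u *\<^sub>R x + v *\<^sub>R y) \<le> u * f x + v * f y"
    using assms xy uv by (simp add: convex_on_def)
  also have "\<dots> \<le> c"
    using xy uv by (intro convex_bound_le) auto
  finally show "u *\<^sub>R x + v *\<^sub>R y \<in> {x \<in> A. f x \<le> c}"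
    using xy uv assms by (auto simp: convex_on_def convexD)
qed

lemma residual_alt_proj_op_on_first:
  assumes "y \<in> C"
  shows "fp_residual (alt_proj_op C D \<alpha>1 \<alpha>2) y = \<alpha>2 *\<^sub>R (closest_point D y - y)"
  using closest_point_self[OF assms]
  by (simp add: fp_residual_def alt_proj_op_def relaxed_proj_def algebra_simps
      flip: scaleR_add_left)

lemma ls_candidate_affine_comb:
  assumes "affine C" "closed C" "C \<noteq> {}" "u + v = 1"
  shows "ls_candidate C S x (u * a + v * b) = u *\<^sub>R ls_candidate C S x a + v *\<^sub>R ls_candidate C S x b"
proof -
  \<comment> \<open>As the weights sum to one, the base point \<open>x\<close> splits into
    \<open>u *\<^sub>R x + v *\<^sub>R x\<close>.\<close>
  have "x + (u * a + v * b) *\<^sub>R fp_residual S x =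
      u *\<^sub>R (x + a *\<^sub>R fp_residual S x) + v *\<^sub>R (x + b *\<^sub>R fp_residual S x)"
    using assms(4) by (simp add: algebra_simps flip: scaleR_add_left)
  then show ?thesis
    using closest_point_affine_comb[OF assms] by (simp add: ls_candidate_def)
qed

theorem theorem2:
  fixes C D :: "(real ^ 'n) set"
    and \<alpha>1 \<alpha>2 \<alpha> \<alpha>max \<epsilon> :: real
    and S :: "real ^ 'n \<Rightarrow> real ^ 'n"
    and x :: "nat \<Rightarrow> real ^ 'n"
    and k :: nat
  assumes "C \<noteq> {}" and "closed C" and "convex C"
    and "D \<noteq> {}" and "closed D" and "convex D"
    and "C \<inter> D \<noteq> {}"
    and "\<alpha>1 \<in> {0<..2}" and "\<alpha>2 \<in> {0<..2}"
    and "0 < \<alpha>" and "\<alpha> < \<alpha>max"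
    and "\<epsilon> \<in> {0<..<1}"
    and "S = alt_proj_op C D \<alpha>1 \<alpha>2"
    and "affine C"
  shows "(\<forall>a\<in>{\<alpha><..\<alpha>max}.
            norm (fp_residual S (ls_candidate C S (x k) a))
              = \<alpha>2 * proj_dist D (ls_candidate C S (x k) a))
       \<and> convex_on {\<alpha><..\<alpha>max} (\<lambda>a. norm (fp_residual S (ls_candidate C S (x k) a)))
       \<and> (\<forall>i_LS<k. convex {a \<in> {\<alpha><..\<alpha>max}. ls_condition C S \<epsilon> (x (i_LS + 1)) (x k) a})"
proof -
  note C = \<open>affine C\<close> \<open>closed C\<close> \<open>C \<noteq> {}\<close>
  let ?z = "ls_candidate C S (x k)"
  let ?f = "\<lambda>a. norm (fp_residual S (?z a))"
  \<comment> \<open>Valid for every real \<open>a\<close>, since each candidate is a projection onto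
    \<open>C\<close>.\<close>
  have eq: "?f a = \<alpha>2 * proj_dist D (?z a)" for a
    using C \<open>\<alpha>2 \<in> {0<..2}\<close> unfolding \<open>S = alt_proj_op C D \<alpha>1 \<alpha>2\<close>
    by (simp add: residual_alt_proj_op_on_first ls_candidate_def closest_point_in_set proj_dist_def)
  have conv: "convex_on {\<alpha><..\<alpha>max} ?f"
    unfolding convex_on_def
  proof (intro conjI ballI allI impI)
    fix a b u v :: real
    assume uv: "0 \<le> u" "0 \<le> v" "u + v = 1"
    have "proj_dist D (?z (u * a + v * b)) \<le> u * proj_dist D (?z a) + v * proj_dist D (?z b)"
      using convex_on_proj_dist[OF \<open>convex D\<close> \<open>closed D\<close> \<open>D \<noteq> {}\<close>] uv
      by (simp add: ls_candidate_affine_comb[OF C] convex_on_def)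
    then have "\<alpha>2 * proj_dist D (?z (u * a + v * b))
        \<le> \<alpha>2 * (u * proj_dist D (?z a) + v * proj_dist D (?z b))"
      using \<open>\<alpha>2 \<in> {0<..2}\<close> by (intro mult_left_mono) auto
    then show "?f (u *\<^sub>R a + v *\<^sub>R b) \<le> u * ?f a + v * ?f b"
      by (simp add: eq algebra_simps)
  qed simp
  \<comment> \<open>The bound \<open>c\<close> stands for
    \<open>(1 - \<epsilon>) * norm (fp_residual S (x (i_LS + 1)))\<close>, which is constant in
    \<open>a\<close>; this covers all indices \<open>i_LS\<close> at once.\<close>
  have "convex {a \<in> {\<alpha><..\<alpha>max}. ?f a \<le> c}" for c
    using conv by (rule convex_on_imp_convex_sublevel)
  then show ?thesis
    using eq conv by (simp add: ls_condition_def)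
qed

end
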